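(* Let $G$ be a clustered graph on $mn$ vertices with $n$ clusters $C_i=\{v_{i,1},\dots,v_{i,m}\}$, $i=1,\dots,n$, and let $G_a$ be its alternating clustered graph. Then $G^\tau$ and $G_a^\tau$ are isomorphic. Moreover, if $G$ and $G^\tau$ are cospectral, then $G_a$ and $G_a^\tau$ are cospectral.
   Context: All graphs are finite, simple and undirected. A clustered graph is a graph whose labelled vertex set is partitioned into clusters of equal size, each cluster being an ordered list of vertices. For a clustered graph with clusters $C_i=\{v_{i,1},\dots,v_{i,m}\}$ ($v_{i,k}$ being the $k$-th vertex of the $i$-th cluster), its graph theoretical partial transpose is the graph on the same vertex set obtained by keeping every edge inside a cluster and every edge joining the $k$-th vertices of two different clusters, and replacing every edge joining the $k$-th vertex of cluster $i$ with the $l$-th vertex of cluster $j$, where $i\neq j$ and $k\neq l$, by the edge joining the $l$-th vertex of cluster $i$ with the $k$-th vertex of cluster $j$. The alternating clustered graph $G_a$ of $G$ is the same graph (same vertices and edges) with the alternative clustering into $m$ clusters $C'_j=\{v_{1,j},v_{2,j},\dots,v_{n,j}\}$, $j=1,\dots,m$, where $v_{i,j}$ is the $i$-th vertex of $C'_j$; $G_a^\tau$ is its partial transpose with respect to this clustering. Cospectral means equal multisets of adjacency eigenvalues. *)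

theory Defs
  imports
    "Graph_Theory.Graph_Theory"
    "Jordan_Normal_Form.Char_Poly"
    Complex_Main
begin

(* Finite simple undirected graphs are the pair_graph structures of Graph_Theory: finite vertex
   set, symmetric and irreflexive arc relation. An undirected edge joining u and v is represented
   by the two arcs (u, v) and (v, u). Isomorphism of such graphs is digraph_iso, applied to them
   through the coercion with_proj. *)

record 'a clustered_graph =
  ugraph :: "'a pair_pre_digraph"
  clusters :: "'a list list"

(* Clusters and positions are counted from 0. *)
definition cvert :: "'a clustered_graph \<Rightarrow> nat \<Rightarrow> nat \<Rightarrow> 'a" where
  "cvert G i k = clusters G ! i ! k"

definition is_clustered_graph :: "nat \<Rightarrow> nat \<Rightarrow> 'a clustered_graph \<Rightarrow> bool" where
  "is_clustered_graph n m G \<longleftrightarrow>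
     pair_graph (ugraph G) \<and>
     length (clusters G) = n \<and>
     (\<forall>C \<in> set (clusters G). length C = m) \<and>
     distinct (concat (clusters G)) \<and>
     set (concat (clusters G)) = pverts (ugraph G)"

definition is_cpos :: "'a clustered_graph \<Rightarrow> nat \<Rightarrow> nat \<Rightarrow> bool" where
  "is_cpos G i k \<longleftrightarrow> i < length (clusters G) \<and> k < length (clusters G ! i)"

definition partial_transpose :: "'a clustered_graph \<Rightarrow> 'a pair_pre_digraph" where
  "partial_transpose G = \<lparr>
     pverts = pverts (ugraph G),
     parcs =
       {(cvert G i k, cvert G j l) | i k j l.
          is_cpos G i k \<and> is_cpos G j l \<and> (i = j \<or> k = l) \<and>
          (cvert G i k, cvert G j l) \<in> parcs (ugraph G)} \<union>
       {(cvert G i l, cvert G j k) | i k j l.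
          is_cpos G i k \<and> is_cpos G j l \<and> i \<noteq> j \<and> k \<noteq> l \<and>
          (cvert G i k, cvert G j l) \<in> parcs (ugraph G)}\<rparr>"

(* The cluster size m is an argument because the list of clusters does not determine it
   when there are no clusters. *)
definition alternating :: "nat \<Rightarrow> 'a clustered_graph \<Rightarrow> 'a clustered_graph" where
  "alternating m G = \<lparr>
     ugraph = ugraph G,
     clusters = map (\<lambda>j. map (\<lambda>i. cvert G i j) [0..<length (clusters G)]) [0..<m]\<rparr>"

definition adjacency_mat :: "'a list \<Rightarrow> 'a pair_pre_digraph \<Rightarrow> complex mat" where
  "adjacency_mat vs G =
     mat (length vs) (length vs) (\<lambda>(p, q). if (vs ! p, vs ! q) \<in> parcs G then 1 else 0)"

(* Multiset of eigenvalues, taken over the complex numbers, with algebraic multiplicity.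
   By adjacency_spectrum_eq below it does not depend on the chosen enumeration of the vertices. *)
definition adjacency_spectrum :: "'a pair_pre_digraph \<Rightarrow> complex multiset" where
  "adjacency_spectrum G =
     proots (char_poly (adjacency_mat (SOME vs. distinct vs \<and> set vs = pverts G) G))"

definition cospectral :: "'a pair_pre_digraph \<Rightarrow> 'b pair_pre_digraph \<Rightarrow> bool" where
  "cospectral G H \<longleftrightarrow> adjacency_spectrum G = adjacency_spectrum H"

lemma char_poly_adjacency_mat_cong:
  assumes "distinct vs" "distinct ws" "set vs = set ws"
  shows "char_poly (adjacency_mat vs G) = char_poly (adjacency_mat ws G)"
proof -
  define N where "N = length vs"
  have lw: "length ws = N"
    using assms distinct_card N_def by metis
  define P :: "complex mat" where "P = mat N N (\<lambda>(p, q). if vs ! p = ws ! q then 1 else 0)"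
  define Q :: "complex mat" where "Q = mat N N (\<lambda>(p, q). if ws ! p = vs ! q then 1 else 0)"
  have inv: "\<exists>f. (\<forall>p<N. f p < N) \<and> (\<forall>p<N. \<forall>q<N. (xs ! p = ys ! q) = (q = f p))"
    if "distinct xs" "distinct ys" "set xs = set ys" "length xs = N" "length ys = N"
    for xs ys :: "'a list"
  proof -
    have "\<forall>p. \<exists>q. p < N \<longrightarrow> q < N \<and> xs ! p = ys ! q"
      using that by (metis in_set_conv_nth)
    then obtain f where "\<forall>p<N. f p < N \<and> xs ! p = ys ! f p" by metis
    then have "(\<forall>p<N. f p < N) \<and> (\<forall>p<N. \<forall>q<N. (xs ! p = ys ! q) = (q = f p))"
      using that by (metis nth_eq_iff_index_eq)
    then show ?thesis by blast
  qed
  obtain f where f: "\<And>p. p < N \<Longrightarrow> f p < N"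
      "\<And>p q. p < N \<Longrightarrow> q < N \<Longrightarrow> (vs ! p = ws ! q) = (q = f p)"
    using inv[OF assms N_def[symmetric] lw] by metis
  have vf: "vs ! p = ws ! f p" if "p < N" for p
    using f that by simp
  have eqf: "ws ! q = vs ! p \<longleftrightarrow> q = f p" if "p < N" "q < N" for p q
    using f(2)[OF that] by auto
  have PQ: "P * Q = 1\<^sub>m N"
  proof (rule eq_matI)
    fix p q assume "p < dim_row (1\<^sub>m N :: complex mat)" "q < dim_col (1\<^sub>m N :: complex mat)"
    then have pq: "p < N" "q < N" by auto
    have "(P * Q) $$ (p, q) = (\<Sum>r<N. P $$ (p, r) * Q $$ (r, q))"
      using pq by (simp add: P_def Q_def scalar_prod_def lessThan_atLeast0)
    also have "\<dots> = (\<Sum>r<N. if r = f p then Q $$ (r, q) else 0)"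
      by (rule sum.cong) (use pq in \<open>auto simp: P_def f\<close>)
    also have "\<dots> = Q $$ (f p, q)"
      using pq f(1) by simp
    also have "\<dots> = (if vs ! p = vs ! q then 1 else 0)"
      using pq f(1) vf by (simp add: Q_def)
    also have "\<dots> = 1\<^sub>m N $$ (p, q)"
      using pq assms(1) by (simp add: N_def nth_eq_iff_index_eq)
    finally show "(P * Q) $$ (p, q) = 1\<^sub>m N $$ (p, q)" .
  qed (auto simp: P_def Q_def)
  have QP: "Q * P = 1\<^sub>m N"
    by (rule mat_mult_left_right_inverse[OF _ _ PQ]) (auto simp: P_def Q_def)
  have A: "adjacency_mat vs G = P * adjacency_mat ws G * Q"
  proof (rule eq_matI)
    fix p q
    assume "p < dim_row (P * adjacency_mat ws G * Q)" "q < dim_col (P * adjacency_mat ws G * Q)"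
    then have pq: "p < N" "q < N" by (auto simp: P_def Q_def)
    have PA: "(P * adjacency_mat ws G) $$ (p, r) = adjacency_mat ws G $$ (f p, r)"
      if "r < N" for r
    proof -
      have "(P * adjacency_mat ws G) $$ (p, r)
          = (\<Sum>s<N. P $$ (p, s) * adjacency_mat ws G $$ (s, r))"
        using pq that lw by (simp add: P_def adjacency_mat_def scalar_prod_def lessThan_atLeast0)
      also have "\<dots> = (\<Sum>s<N. if s = f p then adjacency_mat ws G $$ (s, r) else 0)"
        by (rule sum.cong) (use pq in \<open>auto simp: P_def f\<close>)
      also have "\<dots> = adjacency_mat ws G $$ (f p, r)"
        using pq f(1) by simp
      finally show ?thesis .
    qed
    have "(P * adjacency_mat ws G * Q) $$ (p, q)
        = (\<Sum>r<N. (P * adjacency_mat ws G) $$ (p, r) * Q $$ (r, q))"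
      using pq lw by (simp add: P_def Q_def adjacency_mat_def scalar_prod_def lessThan_atLeast0)
    also have "\<dots> = (\<Sum>r<N. if r = f q then adjacency_mat ws G $$ (f p, r) else 0)"
      by (rule sum.cong) (use pq in \<open>auto simp: PA Q_def eqf\<close>)
    also have "\<dots> = adjacency_mat ws G $$ (f p, f q)"
      using pq f(1) by simp
    also have "\<dots> = adjacency_mat vs G $$ (p, q)"
      using pq f(1) lw vf N_def[symmetric] by (simp add: adjacency_mat_def)
    finally show "adjacency_mat vs G $$ (p, q) = (P * adjacency_mat ws G * Q) $$ (p, q)" ..
  qed (auto simp: P_def Q_def adjacency_mat_def N_def)
  have "similar_mat (adjacency_mat vs G) (adjacency_mat ws G)"
    by (rule similar_matI[OF _ PQ QP A])
      (auto simp: P_def Q_def adjacency_mat_def N_def lw[unfolded N_def])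
  then show ?thesis by (rule char_poly_similar)
qed

lemma adjacency_spectrum_eq:
  assumes "distinct vs" "set vs = pverts G"
  shows "adjacency_spectrum G = proots (char_poly (adjacency_mat vs G))"
proof -
  have "distinct (SOME us. distinct us \<and> set us = pverts G) \<and>
      set (SOME us. distinct us \<and> set us = pverts G) = pverts G"
    by (rule someI[of _ vs]) (use assms in simp)
  then show ?thesis
    unfolding adjacency_spectrum_def
    using char_poly_adjacency_mat_cong[OF _ assms(1), of "SOME us. distinct us \<and> set us = pverts G" G]
      assms(2) by simp
qed

lemma is_cpos_iff:
  "is_clustered_graph n m G \<Longrightarrow> is_cpos G i k \<longleftrightarrow> i < n \<and> k < m"
  by (auto simp: is_clustered_graph_def is_cpos_def)

lemma cvert_alternating:
  "is_clustered_graph n m G \<Longrightarrow> i < n \<Longrightarrow> j < m \<Longrightarrow> cvert (alternating m G) j i = cvert G i j"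
  by (simp add: is_clustered_graph_def cvert_def alternating_def)

end

theory Submission
  imports Defs
begin

text \<open>The two transposes are the same graph, so the identity is an isomorphism. Write a vertex
  as a pair (i, k); alternating the clustering swaps the coordinates. The condition i = j or k = l
  for keeping an edge is symmetric under this swap. Any other edge (i, k)-(j, l) goes to (i, l)-(j,
  k) under both clusterings, up to its orientation. This equality is
  \<open>partial_transpose_alternating\<close>; since alternation leaves the underlying graph alone,
  the claim on cospectrality then becomes trivial.\<close>

lemma digraph_iso_refl:
  assumes "wf_digraph G"
  shows "digraph_iso G G"
proof -
  interpret wf_digraph G by (fact assms)
  \<comment> \<open>\<open>app_iso\<close> takes head and tail from the morphism, so those of
    \<open>G\<close> are put in to get \<open>G\<close> back exactly.\<close>
  let ?id = "\<lparr>iso_verts = id, iso_arcs = id, iso_head = head G, iso_tail = tail G\<rparr>"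
  have "digraph_isomorphism ?id"
    by (simp add: digraph_isomorphism_def assms)
  moreover have "G = app_iso ?id G"
    by (simp add: app_iso_def)
  ultimately show ?thesis
    unfolding digraph_iso_def by (intro exI[of _ ?id] conjI)
qed

lemma is_cpos_alternating:
  assumes "is_clustered_graph n m G"
  shows "is_cpos (alternating m G) k i \<longleftrightarrow> k < m \<and> i < n"
  using assms by (auto simp: is_cpos_def alternating_def is_clustered_graph_def)

lemma cvert_in_pverts:
  assumes "is_clustered_graph n m G" "is_cpos G i k"
  shows "cvert G i k \<in> pverts (ugraph G)"
proof -
  have "cvert G i k \<in> set (clusters G ! i)" "clusters G ! i \<in> set (clusters G)"
    using assms(2) by (simp_all add: is_cpos_def cvert_def)
  then have "cvert G i k \<in> set (concat (clusters G))"
    by auto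
  then show ?thesis
    using assms(1) unfolding is_clustered_graph_def by blast
qed

text \<open>Well-formedness is part of being a digraph isomorphism. It holds because all clusters
  have size \<open>m\<close>, so the ends of a moved arc are again vertices.\<close>

lemma pair_wf_digraph_partial_transpose:
  assumes "is_clustered_graph n m G"
  shows "pair_wf_digraph (partial_transpose G)"
proof
  fix e assume "e \<in> parcs (partial_transpose G)"
  then have "fst e \<in> pverts (ugraph G) \<and> snd e \<in> pverts (ugraph G)"
    unfolding partial_transpose_def using cvert_in_pverts[OF assms]
    by (auto simp: is_cpos_iff[OF assms])
  then show "fst e \<in> pverts (partial_transpose G)" "snd e \<in> pverts (partial_transpose G)"
    by (simp_all add: partial_transpose_def)
qed

lemma parcs_partial_transposeI:
  assumes "is_cpos G i k" "is_cpos G j l" "(cvert G i k, cvert G j l) \<in> parcs (ugraph G)"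
  shows "i = j \<or> k = l \<Longrightarrow> (cvert G i k, cvert G j l) \<in> parcs (partial_transpose G)"
    and "i \<noteq> j \<Longrightarrow> k \<noteq> l \<Longrightarrow> (cvert G i l, cvert G j k) \<in> parcs (partial_transpose G)"
  unfolding partial_transpose_def pair_pre_digraph.simps using assms by blast+

lemma parcs_partial_transposeE:
  assumes "a \<in> parcs (partial_transpose G)"
  obtains (kept) i k j l where "a = (cvert G i k, cvert G j l)" "is_cpos G i k" "is_cpos G j l"
      "i = j \<or> k = l" "(cvert G i k, cvert G j l) \<in> parcs (ugraph G)"
    | (moved) i k j l where "a = (cvert G i l, cvert G j k)" "is_cpos G i k" "is_cpos G j l"
      "i \<noteq> j" "k \<noteq> l" "(cvert G i k, cvert G j l) \<in> parcs (ugraph G)"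
  using assms unfolding partial_transpose_def pair_pre_digraph.simps by blast

text \<open>An arc moved by the transpose of the alternating clustering is the reverse of the arc
  moved by the original transpose, so the two coincide by symmetry.\<close>

lemma partial_transpose_alternating:
  assumes G: "is_clustered_graph n m G"
  shows "partial_transpose (alternating m G) = partial_transpose G"
proof -
  let ?A = "alternating m G"
  have "pair_graph (ugraph G)"
    using G by (simp add: is_clustered_graph_def)
  then have sym: "(v, u) \<in> parcs (ugraph G)" if "(u, v) \<in> parcs (ugraph G)" for u v
    using that pair_sym_digraph.arcs_symmetric pair_bidirected_digraph.axioms(1)
      pair_graph.axioms(2) pair_pseudo_graph.axioms(2) by metis
  have ug: "ugraph ?A = ugraph G"
    by (simp add: alternating_def)
  have pos: "is_cpos ?A k i \<longleftrightarrow> is_cpos G i k" for i k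
    unfolding is_cpos_iff[OF G] is_cpos_alternating[OF G] by blast
  have cv: "cvert ?A k i = cvert G i k" if "is_cpos G i k" for i k
    using that cvert_alternating[OF G] is_cpos_iff[OF G] by blast
  \<comment> \<open>Equal cluster sizes: a position valid in one cluster is valid in all.\<close>
  have swap: "is_cpos G i l" if "is_cpos G i k" "is_cpos G j l" for i j k l
    using that is_cpos_iff[OF G] by blast
  have "a \<in> parcs (partial_transpose G)" if "a \<in> parcs (partial_transpose ?A)" for a
    using that
  proof (cases rule: parcs_partial_transposeE)
    \<comment> \<open>The case variables are named so that \<open>k\<close> and \<open>l\<close> are
      clusters of \<open>?A\<close>, hence positions in \<open>G\<close>.\<close>
    case (kept k i l j)
    then show ?thesis
      using parcs_partial_transposeI(1)[of G i k j l] by (auto simp: pos cv ug)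
  next
    case (moved k i l j)
    have "is_cpos G i k" "is_cpos G j l" "is_cpos G i l" "is_cpos G j k"
      using moved swap[of i k j l] swap[of j l i k] unfolding pos by blast+
    \<comment> \<open>The arc is \<open>(cvert G j k, cvert G i l)\<close>, the image of the
      reversed arc from \<open>cvert G j l\<close> to \<open>cvert G i k\<close>; \<open>sym\<close>
      supplies the latter.\<close>
    with moved show ?thesis
      using parcs_partial_transposeI(2)[of G j l i k] sym[of "cvert G i k" "cvert G j l"]
      by (simp add: cv ug)
  qed
  moreover have "a \<in> parcs (partial_transpose ?A)" if "a \<in> parcs (partial_transpose G)" for a
    using that
  proof (cases rule: parcs_partial_transposeE)
    case (kept i k j l)
    then show ?thesis
      using parcs_partial_transposeI(1)[of ?A k i l j] by (auto simp: pos cv ug)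
  next
    case (moved i k j l)
    have "is_cpos G i l" "is_cpos G j k"
      using moved swap[of i k j l] swap[of j l i k] by blast+
    with moved show ?thesis
      using parcs_partial_transposeI(2)[of ?A l j k i] sym[of "cvert G i k" "cvert G j l"]
      by (simp add: pos cv ug)
  qed
  ultimately have "parcs (partial_transpose ?A) = parcs (partial_transpose G)"
    by blast
  then show ?thesis
    by (simp add: partial_transpose_def ug)
qed

theorem theorem10:
  fixes G :: "'a clustered_graph" and n m :: nat
  assumes "is_clustered_graph n m G"
  shows "digraph_iso (with_proj (partial_transpose G))
           (with_proj (partial_transpose (alternating m G))) \<and>
         (cospectral (ugraph G) (partial_transpose G) \<longrightarrow>
          cospectral (ugraph (alternating m G)) (partial_transpose (alternating m G)))"
proof -
  interpret pair_wf_digraph "partial_transpose G"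
    by (rule pair_wf_digraph_partial_transpose[OF assms])
  have "digraph_iso (with_proj (partial_transpose G)) (with_proj (partial_transpose G))"
    by (rule digraph_iso_refl) (rule wf_digraph)
  moreover have "ugraph (alternating m G) = ugraph G"
    by (simp add: alternating_def)
  \<comment> \<open>After rewriting, the conclusion on cospectrality is its own premise.\<close>
  ultimately show ?thesis
    by (simp add: partial_transpose_alternating[OF assms])
qed

end
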